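(* Let $\mathcal{R}$ be a principal ideal ring, $\mathcal{R}[x]=\mathcal{R}[x_1,\dots,x_N]$ with a fixed global monomial order $<$, and let $I=\langle f_1,\dots,f_m\rangle\subset\mathcal{R}[x]$ be an ideal such that for all $i=1,\dots,m$ the lead coefficient $\mathrm{lc}(f_i)$ is invertible in $\mathcal{R}$. Moreover, assume that for each polynomial $h$ newly added to $G$ in the course of Buchberger's algorithm (described in the context) $\mathrm{lc}(h)$ is invertible in $\mathcal{R}$. Then the algorithm does not need to consider GCD-polynomials and annihilator polynomials; that is, any run of the algorithm in which only the S-polynomials are put into $P$, and in which every polynomial added to $G$ has invertible lead coefficient, terminates and returns a strong Gr\"obner basis of $I$.
   Context: A principal ideal ring is a unital commutative ring in which every ideal is principal (possibly with zero divisors). A monomial order is global if $x^\alpha\ge1$ for all $\alpha$. For $0\neq f\in\mathcal{R}[x]$, $\mathrm{lm}(f)$, $\mathrm{lc}(f)$, $\mathrm{lt}(f)=\mathrm{lc}(f)\mathrm{lm}(f)$ are the lead monomial, lead coefficient and lead term with respect to $<$. $L(F)$ is the ideal generated by the $\mathrm{lt}(f)$, $0\neq f\in F$. A finite set $G\subset\mathcal{R}[x]$ is a strong Gr\"obner basis of an ideal $J$ if $G\subset J$, $L(G)=L(J)$, and for each $f\in J\setminus\{0\}$ there is $g\in G$ with $\mathrm{lt}(g)\mid\mathrm{lt}(f)$. If $a\in b\mathcal{R}$, then $a/b$ denotes any $c\in\mathcal{R}$ with $cb=a$; $\mathrm{lcm}(a,b)$ and $\gcd(a,b)$ denote any generators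 of $a\mathcal{R}\cap b\mathcal{R}$ and $a\mathcal{R}+b\mathcal{R}$. For nonzero $f,g\in\mathcal{R}[x]$ put $t=\mathrm{lcm}(\mathrm{lm}(f),\mathrm{lm}(g))$, $t_f=t/\mathrm{lm}(f)$, $t_g=t/\mathrm{lm}(g)$. - S-polynomial: $\mathrm{spoly}(f,g)=a_ft_ff-a_gt_gg$ with $a=\mathrm{lcm}(\mathrm{lc}(f),\mathrm{lc}(g))$, $a_f=a/\mathrm{lc}(f)$, $a_g=a/\mathrm{lc}(g)$. - GCD-polynomial: $\mathrm{gpoly}(f,g)=b_ft_ff+b_gt_gg$, where $b_f\mathrm{lc}(f)+b_g\mathrm{lc}(g)=\gcd(\mathrm{lc}(f),\mathrm{lc}(g))$. - Annihilator polynomial: $\mathrm{apoly}(f)=cf$, where $c$ generates the annihilator of $\mathrm{lc}(f)$ in $\mathcal{R}$. Normal form $\mathrm{NF}(f,G)$: start with $h=f$; while $h\ne0$ and some $g\in G$ satisfies $\mathrm{lm}(g)\mid\mathrm{lm}(h)$ and $\mathrm{lc}(g)\mid\mathrm{lc}(h)$, replace $h$ by $h-\frac{\mathrm{lc}(h)}{\mathrm{lc}(g)}\frac{\mathrm{lm}(h)}{\mathrm{lm}(g)}g$; return $h$. Buchberger's algorithm: put $G=\{f_1,\dots,f_m\}$ and $P=\{\mathrm{apoly}(f_i)\mid 1\le i\le m\}\cup\{\mathrm{spoly}(f_i,f_j),\mathrm{gpoly}(f_i,f_j)\mid 1\le i<j\le m\}$. While $P\neq\emptyset$: choose and remove some $h\in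 P$; set $h\leftarrow\mathrm{NF}(h,G)$; if $h\ne0$, add to $P$ the polynomial $\mathrm{apoly}(h)$ and all $\mathrm{spoly}(g,h)$, $\mathrm{gpoly}(g,h)$ for $g\in G$, and then add $h$ to $G$. Return $G$. The version with only S-polynomials is obtained by omitting all $\mathrm{apoly}$ and $\mathrm{gpoly}$ entries from $P$. *)

theory Defs
  imports Complex_Main "HOL-Library.Poly_Mapping"
begin

text \<open>
  Ideals of a commutative ring are its submodules when it is regarded as a module over itself.
\<close>

global_interpretation ring_module: module "(*) :: 'a::comm_ring_1 \<Rightarrow> 'a \<Rightarrow> 'a"
  by unfold_locales (simp_all add: algebra_simps)

abbreviation is_ideal :: "'a::comm_ring_1 set \<Rightarrow> bool"
  where "is_ideal \<equiv> module.subspace (*)"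

abbreviation ideal_generated :: "'a::comm_ring_1 set \<Rightarrow> 'a set"
  where "ideal_generated \<equiv> module.span (*)"

definition principal_ideal_ring :: "'a::comm_ring_1 itself \<Rightarrow> bool"
  where "principal_ideal_ring _ \<longleftrightarrow> (\<forall>I::'a set. is_ideal I \<longrightarrow> (\<exists>a. I = ideal_generated {a}))"

definition is_lcm :: "'a::comm_ring_1 \<Rightarrow> 'a \<Rightarrow> 'a \<Rightarrow> bool"
  where "is_lcm a b c \<longleftrightarrow> ideal_generated {c} = ideal_generated {a} \<inter> ideal_generated {b}"


text \<open>
  A monomial is given by its exponent vector, so the product of monomials is written additively,
  the monomial \<open>1\<close> is \<open>0\<close>, and division of a monomial by one of its divisors is subtraction.
  Polynomials in the variables indexed by \<open>'v\<close> form the monoid ring over these exponent vectors.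
\<close>

type_synonym 'v monomial = "'v \<Rightarrow>\<^sub>0 nat"
type_synonym ('v, 'r) mpoly = "'v monomial \<Rightarrow>\<^sub>0 'r"

definition global_monomial_order :: "('v monomial \<Rightarrow> 'v monomial \<Rightarrow> bool) \<Rightarrow> bool"
  where "global_monomial_order le \<longleftrightarrow>
    linear_order {(s, t). le s t} \<and>
    (\<forall>s t u. le s t \<longrightarrow> le (s + u) (t + u)) \<and>
    (\<forall>t. le 0 t)"

definition mono_dvd :: "'v monomial \<Rightarrow> 'v monomial \<Rightarrow> bool"
  where "mono_dvd s t \<longleftrightarrow> (\<exists>u. t = s + u)"

text \<open>
  Since subtraction of exponents is truncated, the exponents of \<open>s + (t - s)\<close> are the maxima of the
  exponents of \<open>s\<close> and \<open>t\<close>.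
\<close>

definition mono_lcm :: "'v monomial \<Rightarrow> 'v monomial \<Rightarrow> 'v monomial"
  where "mono_lcm s t = s + (t - s)"

lemma lookup_mono_lcm:
  "Poly_Mapping.lookup (mono_lcm s t) x = max (Poly_Mapping.lookup s x) (Poly_Mapping.lookup t x)"
  by (simp add: mono_lcm_def lookup_add lookup_minus)


text \<open>
  The lead monomial is meaningful for nonzero polynomials only. However, \<open>lc le 0 = 0\<close> and
  \<open>lt le 0 = 0\<close> hold; in particular, a polynomial with invertible lead coefficient is nonzero.
\<close>

definition lm :: "('v monomial \<Rightarrow> 'v monomial \<Rightarrow> bool) \<Rightarrow> ('v, 'r::zero) mpoly \<Rightarrow> 'v monomial"
  where "lm le f = (THE t. t \<in> Poly_Mapping.keys f \<and> (\<forall>s\<in>Poly_Mapping.keys f. le s t))"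

definition lc :: "('v monomial \<Rightarrow> 'v monomial \<Rightarrow> bool) \<Rightarrow> ('v, 'r::zero) mpoly \<Rightarrow> 'r"
  where "lc le f = Poly_Mapping.lookup f (lm le f)"

definition lt :: "('v monomial \<Rightarrow> 'v monomial \<Rightarrow> bool) \<Rightarrow> ('v, 'r::zero) mpoly \<Rightarrow> ('v, 'r) mpoly"
  where "lt le f = Poly_Mapping.single (lm le f) (lc le f)"

definition lead_ideal ::
  "('v monomial \<Rightarrow> 'v monomial \<Rightarrow> bool) \<Rightarrow> ('v, 'r::comm_ring_1) mpoly set \<Rightarrow> ('v, 'r) mpoly set"
  where "lead_ideal le F = ideal_generated (lt le ` (F - {0}))"

definition strong_groebner_basis ::
  "('v monomial \<Rightarrow> 'v monomial \<Rightarrow> bool) \<Rightarrow> ('v, 'r::comm_ring_1) mpoly set \<Rightarrow>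
    ('v, 'r) mpoly set \<Rightarrow> bool"
  where "strong_groebner_basis le G J \<longleftrightarrow>
    finite G \<and> G \<subseteq> J \<and> lead_ideal le G = lead_ideal le J \<and>
    (\<forall>f\<in>J - {0}. \<exists>g\<in>G - {0}. lt le g dvd lt le f)"


text \<open>
  Least common multiples and quotients in the coefficient ring are not unique, hence
  S-polynomials and reduction steps are relations that allow every possible choice.
\<close>

definition is_spoly ::
  "('v monomial \<Rightarrow> 'v monomial \<Rightarrow> bool) \<Rightarrow> ('v, 'r::comm_ring_1) mpoly \<Rightarrow> ('v, 'r) mpoly \<Rightarrow>
    ('v, 'r) mpoly \<Rightarrow> bool"
  where "is_spoly le f g p \<longleftrightarrow>
    (let t = mono_lcm (lm le f) (lm le g) in
     \<exists>a af ag. is_lcm (lc le f) (lc le g) a \<and> af * lc le f = a \<and> ag * lc le g = a \<and>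
       p = Poly_Mapping.single (t - lm le f) af * f - Poly_Mapping.single (t - lm le g) ag * g)"

definition reduction_step ::
  "('v monomial \<Rightarrow> 'v monomial \<Rightarrow> bool) \<Rightarrow> ('v, 'r::comm_ring_1) mpoly set \<Rightarrow>
    ('v, 'r) mpoly \<Rightarrow> ('v, 'r) mpoly \<Rightarrow> bool"
  where "reduction_step le G h h' \<longleftrightarrow>
    h \<noteq> 0 \<and>
    (\<exists>g\<in>G - {0}. \<exists>c. mono_dvd (lm le g) (lm le h) \<and> c * lc le g = lc le h \<and>
       h' = h - Poly_Mapping.single (lm le h - lm le g) c * g)"


text \<open>
  Buchberger's algorithm with S-polynomials only, as a nondeterministic transition system.
  \<open>Outer G P\<close> is the state in which the condition \<open>P \<noteq> {}\<close> of the main loop is tested.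
  \<open>Normalizing h G P\<close> is a state inside the normal form loop started on the polynomial
  removed from \<open>P\<close>, where \<open>h\<close> is the current intermediate polynomial. Single reduction steps are
  transitions of their own, so termination of a run includes termination of every normal form
  computation.
\<close>

datatype 'p buchberger_state =
    Outer "'p set" "'p set"
  | Normalizing 'p "'p set" "'p set"

fun basis :: "'p buchberger_state \<Rightarrow> 'p set"
  where
    "basis (Outer G P) = G"
  | "basis (Normalizing h G P) = G"

inductive buchberger_step ::
  "('v monomial \<Rightarrow> 'v monomial \<Rightarrow> bool) \<Rightarrow> ('v, 'r::comm_ring_1) mpoly buchberger_state \<Rightarrow>
    ('v, 'r) mpoly buchberger_state \<Rightarrow> bool"
  for le
  where
    choose:
      "h \<in> P \<Longrightarrow> buchberger_step le (Outer G P) (Normalizing h G (P - {h}))"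
  | reduce:
      "reduction_step le G h h' \<Longrightarrow>
        buchberger_step le (Normalizing h G P) (Normalizing h' G P)"
  | discard:
      "buchberger_step le (Normalizing 0 G P) (Outer G P)"
  | add:
      "h \<noteq> 0 \<Longrightarrow> \<nexists>h'. reduction_step le G h h' \<Longrightarrow> \<forall>g\<in>G. is_spoly le g h (s g) \<Longrightarrow>
        buchberger_step le (Normalizing h G P) (Outer (insert h G) (P \<union> s ` G))"

definition buchberger_initial ::
  "('v monomial \<Rightarrow> 'v monomial \<Rightarrow> bool) \<Rightarrow> ('v, 'r::comm_ring_1) mpoly list \<Rightarrow>
    ('v, 'r) mpoly buchberger_state \<Rightarrow> bool"
  where "buchberger_initial le fs S \<longleftrightarrow>
    (\<exists>s. (\<forall>i j. i < j \<and> j < length fs \<longrightarrow> is_spoly le (fs ! i) (fs ! j) (s i j)) \<and>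
         S = Outer (set fs) {s i j |i j. i < j \<and> j < length fs})"

definition buchberger_step_unit ::
  "('v monomial \<Rightarrow> 'v monomial \<Rightarrow> bool) \<Rightarrow> ('v, 'r::comm_ring_1) mpoly buchberger_state \<Rightarrow>
    ('v, 'r) mpoly buchberger_state \<Rightarrow> bool"
  where "buchberger_step_unit le S S' \<longleftrightarrow>
    buchberger_step le S S' \<and> (\<forall>h\<in>basis S' - basis S. lc le h dvd 1)"

end

theory Submission
  imports Defs "HOL-Library.Infinite_Set"
begin

text \<open>
  If all lead coefficients are units, then divisibility of lead terms is divisibility of lead
  monomials, and the cancellation of two lead terms is a multiple of the S-polynomial, for any choice
  of the least common multiple. So Buchberger's criterion holds as over a field: if every
  S-polynomial of \<open>G\<close> is a combination of multiples of elements of \<open>G\<close> whose lead monomials lie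
  below the lcm, then in a representation of an element of the ideal with least maximal monomial,
  that monomial cannot cancel. Termination follows from Dickson's lemma: a polynomial added to the
  basis has a lead monomial that is divisible by no earlier one, and while the basis is constant,
  the number of pending S-polynomials and the lead monomial of the current one decrease
  lexicographically.
\<close>

section \<open>Monomials, least common multiples and S-polynomials\<close>

text \<open>Induction on the set of variables: every sequence of exponents of the new variable has a
  monotone subsequence, and passing to a further subsequence preserves the monotonicity already
  achieved for the other variables.\<close>

lemma dickson_monoseq:
  fixes \<sigma> :: "nat \<Rightarrow> 'v monomial"
  assumes "finite A"
  shows "\<exists>r. strict_mono r \<and>
    (\<forall>x\<in>A. incseq (\<lambda>n. Poly_Mapping.lookup (\<sigma> (r n)) x))"
  using assms
proof (induction A rule: finite_induct)
  case empty
  show ?case using strict_mono_id by blast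
next
  case (insert x A)
  then obtain r where r: "strict_mono r"
    "\<forall>y\<in>A. incseq (\<lambda>n. Poly_Mapping.lookup (\<sigma> (r n)) y)" by blast
  define X where "X n = Poly_Mapping.lookup (\<sigma> (r n)) x" for n
  obtain q where q: "strict_mono q" "monoseq (\<lambda>n. X (q n))"
    using seq_monosub by blast
  \<comment> \<open>A decreasing sequence of naturals is constant from the point where its minimum
    is attained, so cutting off the first \<open>N\<close> terms makes it increasing as
    well.\<close>
  have "\<exists>N. incseq (\<lambda>n. X (q (n + N)))"
  proof (cases "incseq (\<lambda>n. X (q n))")
    case True
    then show ?thesis by (intro exI[of _ 0]) simp
  next
    case False
    with q(2) have dec: "X (q n) \<le> X (q m)" if "m \<le> n" for m n
      using that by (auto simp: monoseq_iff decseq_def)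
    define k where "k = (LEAST k. k \<in> range (\<lambda>n. X (q n)))"
    have "k \<in> range (\<lambda>n. X (q n))" unfolding k_def by (rule LeastI_ex) blast
    then obtain N where N: "X (q N) = k" by auto
    have "k \<le> X (q n)" for n unfolding k_def by (rule Least_le) simp
    with dec[of N] N have "X (q (n + N)) = k" for n by (simp add: le_antisym)
    then show ?thesis by (intro exI[of _ N]) (simp add: incseq_def)
  qed
  then obtain N where N: "incseq (\<lambda>n. X (q (n + N)))" by blast
  define p where "p n = q (n + N)" for n
  have p: "strict_mono p" using q(1) by (simp add: p_def strict_mono_def)
  have "incseq (\<lambda>n. Poly_Mapping.lookup (\<sigma> (r (p n))) y)" if "y \<in> insert x A" for y
  proof (cases "y = x")
    case True
    then show ?thesis using N by (simp add: X_def p_def)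
  next
    case False
    with that r(2) have "incseq (\<lambda>n. Poly_Mapping.lookup (\<sigma> (r n)) y)" by blast
    then show ?thesis using strict_mono_mono[OF p] by (auto simp: incseq_def mono_def)
  qed
  moreover have "strict_mono (\<lambda>n. r (p n))"
    using strict_mono_compose[OF r(1) p] .
  ultimately show ?case by (intro exI[of _ "\<lambda>n. r (p n)"]) blast
qed

lemma mono_dvdI:
  assumes "\<And>x. Poly_Mapping.lookup s x \<le> Poly_Mapping.lookup t x"
  shows "mono_dvd s t"
  unfolding mono_dvd_def
  by (rule exI[of _ "t - s"], rule poly_mapping_eqI) (simp add: lookup_add lookup_minus assms)

text \<open>As \<open>'v\<close> is finite, all exponents can be made increasing along one
  subsequence; its first two terms then divide each other in order.\<close>

lemma dickson:
  fixes \<sigma> :: "nat \<Rightarrow> 'v::finite monomial"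
  obtains i j where "i < j" "mono_dvd (\<sigma> i) (\<sigma> j)"
proof -
  obtain r where r: "strict_mono r"
    "\<forall>x. incseq (\<lambda>n. Poly_Mapping.lookup (\<sigma> (r n)) x)"
    using dickson_monoseq[of "UNIV :: 'v set" \<sigma>] by auto
  have "mono_dvd (\<sigma> (r 0)) (\<sigma> (r 1))"
    using r(2) by (intro mono_dvdI) (simp add: incseq_def)
  moreover have "r 0 < r 1" using r(1) by (simp add: strict_mono_def)
  ultimately show thesis using that by blast
qed

section \<open>Divisors and least common multiples of monomials\<close>

lemma mono_dvd_minus: "mono_dvd s t \<Longrightarrow> t - s + s = t"
  by (auto simp: mono_dvd_def add.commute)

lemma mono_dvd_mono_lcm:
  "mono_dvd s (mono_lcm s t)" "mono_dvd t (mono_lcm s t)"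
  by (simp_all add: mono_dvdI lookup_mono_lcm)

text \<open>The witness \<open>w\<close> is the cofactor of the lcm in the common multiple
  \<open>u + s\<close>. It is what turns an arbitrary cancellation of two lead terms into a multiple
  of the minimal one.\<close>

lemma common_multiple_mono_lcm:
  fixes s t u v :: "'v monomial"
  assumes "u + s = v + t"
  obtains w where "u = w + (mono_lcm s t - s)" "v = w + (mono_lcm s t - t)"
    "u + s = w + mono_lcm s t"
proof
  have eq: "Poly_Mapping.lookup u x + Poly_Mapping.lookup s x
      = Poly_Mapping.lookup v x + Poly_Mapping.lookup t x" for x
    using arg_cong[OF assms, of "\<lambda>p. Poly_Mapping.lookup p x"] by (simp add: lookup_add)
  show "u = (u + s - mono_lcm s t) + (mono_lcm s t - s)"
    apply (rule poly_mapping_eqI)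
    subgoal for x using eq[of x] by (simp add: lookup_add lookup_minus lookup_mono_lcm max_def)
    done
  show "v = (u + s - mono_lcm s t) + (mono_lcm s t - t)"
    apply (rule poly_mapping_eqI)
    subgoal for x using eq[of x] by (simp add: lookup_add lookup_minus lookup_mono_lcm max_def)
    done
  show "u + s = (u + s - mono_lcm s t) + mono_lcm s t"
    apply (rule poly_mapping_eqI)
    subgoal for x using eq[of x] by (simp add: lookup_add lookup_minus lookup_mono_lcm max_def)
    done
qed

text \<open>\<open>update_induct\<close> inserts a fresh key, which amounts to adding a single term.
  The resulting rule suits properties that are additive in the polynomial.\<close>

lemma single_plus_induct [case_names zero single_plus]:
  fixes f :: "'a \<Rightarrow>\<^sub>0 'b::monoid_add"
  assumes "P 0" and "\<And>a b f. P f \<Longrightarrow> P (Poly_Mapping.single a b + f)"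
  shows "P f"
proof (induction f rule: update_induct)
  case const
  show ?case by (rule assms)
next
  case (update f a b)
  then have "Poly_Mapping.update a b f = Poly_Mapping.single a b + f"
    by (intro poly_mapping_eqI)
      (auto simp: lookup_update lookup_add lookup_single in_keys_iff when_def)
  with update show ?case using assms(2) by simp
qed

lemma lookup_single_times:
  fixes f :: "('v, 'r::comm_ring_1) mpoly"
  shows "Poly_Mapping.lookup (Poly_Mapping.single u c * f) (u + s) = c * Poly_Mapping.lookup f s"
  by (induction f rule: single_plus_induct)
    (auto simp: distrib_left lookup_add mult_single lookup_single when_def)

lemma keys_single_times:
  fixes f :: "('v, 'r::comm_ring_1) mpoly"
  shows "Poly_Mapping.keys (Poly_Mapping.single u c * f) \<subseteq> (+) u ` Poly_Mapping.keys f"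
  using keys_mult[of "Poly_Mapping.single u c" f] by (auto split: if_splits)

section \<open>Least common multiples of coefficients and S-polynomials\<close>

lemma mem_ideal_generated_singleton: "x \<in> ideal_generated {a} \<longleftrightarrow> a dvd x"
  for a :: "'a::comm_ring_1"
  by (auto simp: ring_module.span_singleton dvd_def mult.commute)

lemma ex_is_lcm:
  fixes a b :: "'a::comm_ring_1"
  assumes "principal_ideal_ring TYPE('a)"
  shows "\<exists>c. is_lcm a b c"
proof -
  have "is_ideal (ideal_generated {a} \<inter> ideal_generated {b})"
    by (intro ring_module.subspace_inter ring_module.subspace_span)
  then show ?thesis
    using assms unfolding principal_ideal_ring_def is_lcm_def by metis
qed

text \<open>Used twice: for \<open>x = c\<close>, to obtain the cofactors in an S-polynomial, and
  for \<open>x = 1\<close>, to see that an lcm of units is a unit.\<close>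

lemma is_lcm_dvd_iff:
  assumes "is_lcm a b c"
  shows "c dvd x \<longleftrightarrow> a dvd x \<and> b dvd x"
proof -
  have "x \<in> ideal_generated {c} \<longleftrightarrow> x \<in> ideal_generated {a} \<inter> ideal_generated {b}"
    using assms by (simp add: is_lcm_def)
  then show ?thesis by (simp add: mem_ideal_generated_singleton)
qed

text \<open>The principal ideal hypothesis enters the argument here: it ensures that the algorithm
  is never stuck for want of an S-polynomial.\<close>

lemma ex_is_spoly:
  fixes f g :: "('v, 'r::comm_ring_1) mpoly"
  assumes "principal_ideal_ring TYPE('r)"
  shows "\<exists>p. is_spoly le f g p"
proof -
  obtain a where a: "is_lcm (lc le f) (lc le g) a" using ex_is_lcm[OF assms] by blast
  with is_lcm_dvd_iff[OF a, of a] obtain af ag where "af * lc le f = a" "ag * lc le g = a"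
    by (metis dvd_def dvd_refl mult.commute)
  with a show ?thesis unfolding is_spoly_def Let_def by blast
qed

lemma is_spolyE:
  assumes "is_spoly le f g p"
  obtains a af ag where "is_lcm (lc le f) (lc le g) a" "af * lc le f = a" "ag * lc le g = a"
    "p = Poly_Mapping.single (mono_lcm (lm le f) (lm le g) - lm le f) af * f -
      Poly_Mapping.single (mono_lcm (lm le f) (lm le g) - lm le g) ag * g"
  using assms unfolding is_spoly_def Let_def by blast

lemma is_spoly_mem_ideal:
  assumes "is_spoly le f g p" "is_ideal I" "f \<in> I" "g \<in> I"
  shows "p \<in> I"
proof -
  obtain u v where "p = u * f - v * g" using assms(1) by (rule is_spolyE)
  then show ?thesis
    using assms by (simp add: ring_module.subspace_diff ring_module.subspace_scale)
qed

section \<open>Combinations with bounded monomials and the criterion\<close>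

text \<open>The set \<open>U\<close> restricts the lead positions \<open>u + lm le g\<close> of the
  individual summands, not the monomials of their sum, so that cancellation between summands stays
  visible. For \<open>U\<close> strictly below a monomial these are the standard representations of
  Buchberger's criterion.\<close>

inductive_set combinations ::
  "('v monomial \<Rightarrow> 'v monomial \<Rightarrow> bool) \<Rightarrow> ('v, 'r::comm_ring_1) mpoly set \<Rightarrow>
    'v monomial set \<Rightarrow> ('v, 'r) mpoly set"
  for le G U
  where
    zero: "0 \<in> combinations le G U"
  | step: "p \<in> combinations le G U \<Longrightarrow> g \<in> G \<Longrightarrow> u + lm le g \<in> U \<Longrightarrow>
      p + Poly_Mapping.single u c * g \<in> combinations le G U"

lemma combinations_mono:
  assumes "p \<in> combinations le G U" "G \<subseteq> G'" "U \<subseteq> U'"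
  shows "p \<in> combinations le G' U'"
  using assms by (induction rule: combinations.induct) (auto intro: combinations.intros)

lemma combinations_generator:
  assumes "g \<in> G" "u + lm le g \<in> U"
  shows "Poly_Mapping.single u c * g \<in> combinations le G U"
  using combinations.step[OF combinations.zero assms] by simp

lemma combinations_add:
  assumes "p \<in> combinations le G U" "q \<in> combinations le G U"
  shows "p + q \<in> combinations le G U"
  using assms(2,1)
  by (induction rule: combinations.induct)
    (auto simp: add.assoc[symmetric] intro: combinations.intros)

lemma combinations_shift:
  assumes "p \<in> combinations le G U"
  shows "Poly_Mapping.single w c * p \<in> combinations le G ((+) w ` U)"
  using assms
proof (induction rule: combinations.induct)
  case zero
  then show ?case by (simp add: combinations.zero)
next
  case (step p g u d)
  have "Poly_Mapping.single w c * p + Poly_Mapping.single (w + u) (c * d) * g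
      \<in> combinations le G ((+) w ` U)"
    using step by (intro combinations.step) (auto simp: add.assoc)
  then show ?case by (simp add: distrib_left mult.assoc[symmetric] mult_single)
qed

lemma combinations_uminus:
  assumes "p \<in> combinations le G U"
  shows "- p \<in> combinations le G U"
  using combinations_shift[OF assms, of 0 "- 1"] by (simp add: single_uminus)

text \<open>Each polynomial coefficient is split into its terms. A bound on the monomials is
  supplied afterwards by \<open>combinations_bounded\<close>.\<close>

lemma ideal_generated_combinations:
  assumes "p \<in> ideal_generated G"
  shows "p \<in> combinations le G UNIV"
  using assms
proof (induction rule: ring_module.span_induct_alt)
  case base
  show ?case by (rule combinations.zero)
next
  case (step q g p)
  have "q * g \<in> combinations le G UNIV"
    by (induction q rule: single_plus_induct)
      (auto simp: distrib_right step intro!: combinations.zero combinations_add combinations_generator)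
  with step show ?case by (simp add: combinations_add)
qed

section \<open>Global monomial orders and lead monomials\<close>

locale monomial_order =
  fixes le :: "'v::finite monomial \<Rightarrow> 'v monomial \<Rightarrow> bool"  (infix "\<sqsubseteq>" 50)
  assumes global: "global_monomial_order le"
begin

abbreviation less :: "'v monomial \<Rightarrow> 'v monomial \<Rightarrow> bool"  (infix "\<sqsubset>" 50)
  where "s \<sqsubset> t \<equiv> s \<sqsubseteq> t \<and> s \<noteq> t"

lemma le_refl: "s \<sqsubseteq> s"
  using global by (auto simp: global_monomial_order_def order_on_defs refl_on_def)

lemma le_trans: "s \<sqsubseteq> t \<Longrightarrow> t \<sqsubseteq> u \<Longrightarrow> s \<sqsubseteq> u"
  using global by (auto simp: global_monomial_order_def order_on_defs trans_def)

lemma le_antisym: "s \<sqsubseteq> t \<Longrightarrow> t \<sqsubseteq> s \<Longrightarrow> s = t"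
  using global by (auto simp: global_monomial_order_def order_on_defs antisym_def)

lemma less_trans:
  "s \<sqsubset> t \<Longrightarrow> t \<sqsubseteq> u \<Longrightarrow> s \<sqsubset> u"
  "s \<sqsubseteq> t \<Longrightarrow> t \<sqsubset> u \<Longrightarrow> s \<sqsubset> u"
  using le_trans le_antisym by metis+

lemma le_linear: "s \<sqsubseteq> t \<or> t \<sqsubseteq> s"
  using global le_refl[of s]
  by (cases "s = t") (auto simp: global_monomial_order_def order_on_defs total_on_def)

lemma le_add: "s \<sqsubseteq> t \<Longrightarrow> u + s \<sqsubseteq> u + t"
  using global by (auto simp: global_monomial_order_def add.commute)

lemma le_add_right: "s \<sqsubseteq> s + u"
  using global le_add[of 0 u s] by (simp add: global_monomial_order_def)

text \<open>Along an infinite descending chain, Dickson's lemma finds an earlier monomial dividing a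
  later one; but a divisor is never larger in a global order.\<close>

lemma wf_less: "wf {(s, t). s \<sqsubset> t}"
  unfolding wf_iff_no_infinite_down_chain
proof
  assume "\<exists>\<sigma>. \<forall>i. (\<sigma> (Suc i), \<sigma> i) \<in> {(s, t). s \<sqsubset> t}"
  then obtain \<sigma> where \<sigma>: "\<sigma> (Suc i) \<sqsubset> \<sigma> i" for i by auto
  have less: "\<sigma> j \<sqsubset> \<sigma> i" if "i < j" for i j
    using that
  proof (induction rule: less_Suc_induct)
    case (1 i)
    show ?case by (rule \<sigma>)
  next
    case (2 i j k)
    then show ?case by (metis less_trans)
  qed
  obtain i j where "i < j" "mono_dvd (\<sigma> i) (\<sigma> j)" by (rule dickson)
  moreover from this have "\<sigma> i \<sqsubseteq> \<sigma> j"
    using le_add_right by (auto simp: mono_dvd_def)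
  ultimately show False using less le_antisym by blast
qed

lemma ex_maximal:
  assumes "finite A" "A \<noteq> {}"
  shows "\<exists>t\<in>A. \<forall>s\<in>A. s \<sqsubseteq> t"
  using assms
proof (induction A rule: finite_ne_induct)
  case (singleton x)
  show ?case by (simp add: le_refl)
next
  case (insert x A)
  then obtain t where t: "t \<in> A" "\<forall>s\<in>A. s \<sqsubseteq> t" by blast
  show ?case
  proof (cases "x \<sqsubseteq> t")
    case True
    with t show ?thesis by blast
  next
    case False
    then have "t \<sqsubseteq> x" using le_linear by blast
    with t le_trans le_refl have "\<forall>s\<in>insert x A. s \<sqsubseteq> x" by blast
    then show ?thesis by blast
  qed
qed

lemma lm_eqI:
  assumes "t \<in> Poly_Mapping.keys f" "\<And>s. s \<in> Poly_Mapping.keys f \<Longrightarrow> s \<sqsubseteq> t"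
  shows "lm le f = t"
  unfolding lm_def using assms le_antisym by (intro the_equality) blast+

lemma lm_in_keys:
  assumes "f \<noteq> 0"
  shows "lm le f \<in> Poly_Mapping.keys f"
  using ex_maximal[of "Poly_Mapping.keys f"] assms lm_eqI[of _ f] by auto

lemma keys_le_lm:
  assumes "s \<in> Poly_Mapping.keys f"
  shows "s \<sqsubseteq> lm le f"
proof -
  obtain t where "t \<in> Poly_Mapping.keys f" "\<forall>s\<in>Poly_Mapping.keys f. s \<sqsubseteq> t"
    using ex_maximal[OF finite_keys] assms by blast
  with lm_eqI[of t f] assms show ?thesis by blast
qed

lemma lc_unit_nonzero:
  fixes f :: "('v, 'r::comm_ring_1) mpoly"
  shows "lc le f dvd 1 \<Longrightarrow> f \<noteq> 0"
  by (auto simp: lc_def)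

lemma keys_single_times_le:
  fixes g :: "('v, 'r::comm_ring_1) mpoly"
  assumes "s \<in> Poly_Mapping.keys (Poly_Mapping.single u c * g)"
  shows "s \<sqsubseteq> u + lm le g"
  using keys_single_times[of u c g] assms keys_le_lm le_add by blast

lemma lookup_single_times_lm:
  fixes g :: "('v, 'r::comm_ring_1) mpoly"
  shows "Poly_Mapping.lookup (Poly_Mapping.single u c * g) (u + lm le g) = c * lc le g"
  by (simp add: lookup_single_times lc_def)

text \<open>The cancellation behind both S-polynomials and reduction steps. The monomial
  \<open>t\<close> is only an upper bound, since the coefficient there may vanish in a ring with
  zero divisors.\<close>

lemma keys_diff_less:
  fixes f g :: "('v, 'r::comm_ring_1) mpoly"
  assumes "\<And>s. s \<in> Poly_Mapping.keys f \<Longrightarrow> s \<sqsubseteq> t"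
    and "\<And>s. s \<in> Poly_Mapping.keys g \<Longrightarrow> s \<sqsubseteq> t"
    and "Poly_Mapping.lookup f t = Poly_Mapping.lookup g t"
  shows "Poly_Mapping.keys (f - g) \<subseteq> {s. s \<sqsubset> t}"
proof
  fix s assume s: "s \<in> Poly_Mapping.keys (f - g)"
  then have "s \<noteq> t" using assms(3) by (auto simp: in_keys_iff lookup_minus)
  moreover have "s \<sqsubseteq> t" using s keys_diff[of f g] assms(1,2) by blast
  ultimately show "s \<in> {s. s \<sqsubset> t}" by simp
qed

lemma keys_combinations:
  fixes G :: "('v, 'r::comm_ring_1) mpoly set"
  assumes "p \<in> combinations le G U" "\<And>s t. s \<sqsubseteq> t \<Longrightarrow> t \<in> U \<Longrightarrow> s \<in> U"
  shows "Poly_Mapping.keys p \<subseteq> U"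
  using assms(1)
proof (induction rule: combinations.induct)
  case (step p g u c)
  have "Poly_Mapping.keys (Poly_Mapping.single u c * g) \<subseteq> U"
    using keys_single_times_le assms(2) step(3) by blast
  with step(4) keys_add[of p "Poly_Mapping.single u c * g"] show ?case by blast
qed simp

lemma combinations_bounded:
  fixes G :: "('v, 'r::comm_ring_1) mpoly set"
  assumes "p \<in> combinations le G U" "p \<noteq> 0"
  shows "\<exists>t\<in>U. p \<in> combinations le G {s. s \<sqsubseteq> t}"
proof -
  \<comment> \<open>Partial sums may vanish, so the case \<open>p = 0\<close> has to be carried
    through the induction.\<close>
  have "p = 0 \<or> ?thesis"
    using assms(1)
  proof (induction rule: combinations.induct)
    case (step p g u c)
    have g: "Poly_Mapping.single u c * g \<in> combinations le G {s. s \<sqsubseteq> u + lm le g}"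
      using step(2) by (intro combinations_generator) (simp_all add: le_refl)
    show ?case
    proof (cases "p = 0")
      case True
      with g step(3) show ?thesis by auto
    next
      case False
      with step obtain t where t: "t \<in> U" "p \<in> combinations le G {s. s \<sqsubseteq> t}" by blast
      obtain m where m: "m \<in> U" "t \<sqsubseteq> m" "u + lm le g \<sqsubseteq> m"
        using le_linear le_refl t(1) step(3) by blast
      have "p \<in> combinations le G {s. s \<sqsubseteq> m}"
        using t(2) m(2) le_trans by (intro combinations_mono[OF t(2)]) blast+
      moreover have "Poly_Mapping.single u c * g \<in> combinations le G {s. s \<sqsubseteq> m}"
        using m(3) le_trans by (intro combinations_mono[OF g]) blast+
      ultimately show ?thesis using m(1) combinations_add by blast
    qed
  qed simp
  with assms(2) show ?thesis by blast
qed

lemma keys_spoly: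
  fixes f g :: "('v, 'r::comm_ring_1) mpoly"
  assumes "is_spoly le f g p"
  shows "Poly_Mapping.keys p \<subseteq> {s. s \<sqsubset> mono_lcm (lm le f) (lm le g)}"
proof -
  let ?t = "mono_lcm (lm le f) (lm le g)"
  obtain a af ag where a: "af * lc le f = a" "ag * lc le g = a"
    "p = Poly_Mapping.single (?t - lm le f) af * f - Poly_Mapping.single (?t - lm le g) ag * g"
    using assms by (rule is_spolyE)
  have t: "?t - lm le f + lm le f = ?t" "?t - lm le g + lm le g = ?t"
    by (intro mono_dvd_minus mono_dvd_mono_lcm)+
  show ?thesis unfolding a(3)
    using keys_single_times_le[of _ "?t - lm le f" af f]
      keys_single_times_le[of _ "?t - lm le g" ag g]
      lookup_single_times_lm[of "?t - lm le f" af f]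
      lookup_single_times_lm[of "?t - lm le g" ag g] a(1,2)
    unfolding t by (intro keys_diff_less) simp_all
qed

lemma reduction_stepE:
  fixes G :: "('v, 'r::comm_ring_1) mpoly set"
  assumes "reduction_step le G h h'"
  obtains g u c where "g \<in> G" "u + lm le g = lm le h" "h' = h - Poly_Mapping.single u c * g"
    "Poly_Mapping.keys h' \<subseteq> {s. s \<sqsubset> lm le h}"
proof -
  obtain g c where g: "g \<in> G" "mono_dvd (lm le g) (lm le h)" "c * lc le g = lc le h"
    "h' = h - Poly_Mapping.single (lm le h - lm le g) c * g"
    using assms unfolding reduction_step_def by blast
  have u: "lm le h - lm le g + lm le g = lm le h" using g(2) by (rule mono_dvd_minus)
  have "Poly_Mapping.keys h' \<subseteq> {s. s \<sqsubset> lm le h}"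
    unfolding g(4)
    using keys_single_times_le[of _ "lm le h - lm le g" c g] keys_le_lm[of _ h]
      lookup_single_times_lm[of "lm le h - lm le g" c g] g(3)
    unfolding u by (intro keys_diff_less) (simp_all add: lc_def)
  with g(1,4) u that show thesis by blast
qed

text \<open>A unit divides every coefficient, so only the monomials can obstruct a reduction by
  \<open>g\<close>. Termination of the algorithm rests on this.\<close>

lemma irreducible_not_mono_dvd:
  fixes G :: "('v, 'r::comm_ring_1) mpoly set"
  assumes "h \<noteq> 0" "\<nexists>h'. reduction_step le G h h'" "g \<in> G" "lc le g dvd 1"
  shows "\<not> mono_dvd (lm le g) (lm le h)"
proof
  assume "mono_dvd (lm le g) (lm le h)"
  moreover have "g \<noteq> 0" using assms(4) by (rule lc_unit_nonzero)
  moreover have "lc le g dvd lc le h" using assms(4) by (metis dvd_trans one_dvd)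
  then obtain c where "c * lc le g = lc le h" by (metis dvd_def mult.commute)
  ultimately show False
    using assms(1-3) unfolding reduction_step_def by blast
qed

text \<open>
  For unit lead coefficients, the S-polynomial generates all cancellations of two lead terms.
\<close>

definition cancellation_standard :: "('v, 'r::comm_ring_1) mpoly set \<Rightarrow> ('v, 'r) mpoly \<Rightarrow>
    ('v, 'r) mpoly \<Rightarrow> bool"
  where "cancellation_standard G f g \<longleftrightarrow>
    (\<forall>u v c d. u + lm le f = v + lm le g \<and> c * lc le f = d * lc le g \<longrightarrow>
      Poly_Mapping.single u c * f - Poly_Mapping.single v d * g
        \<in> combinations le G {s. s \<sqsubset> u + lm le f})"

lemma cancellation_standardI:
  assumes "\<And>u v c d. u + lm le f = v + lm le g \<Longrightarrow> c * lc le f = d * lc le g \<Longrightarrow>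
      Poly_Mapping.single u c * f - Poly_Mapping.single v d * g
        \<in> combinations le G {s. s \<sqsubset> u + lm le f}"
  shows "cancellation_standard G f g"
  unfolding cancellation_standard_def by (intro allI impI, elim conjE) (rule assms)

lemma cancellation_standardD:
  assumes "cancellation_standard G f g" "u + lm le f = v + lm le g" "c * lc le f = d * lc le g"
  shows "Poly_Mapping.single u c * f - Poly_Mapping.single v d * g
        \<in> combinations le G {s. s \<sqsubset> u + lm le f}"
  using assms(1)[unfolded cancellation_standard_def, rule_format, OF conjI[OF assms(2,3)]] .

lemma cancellation_standard_commute:
  assumes "cancellation_standard G f g"
  shows "cancellation_standard G g f"
proof (rule cancellation_standardI)
  fix u v c d assume *: "u + lm le g = v + lm le f" "c * lc le g = d * lc le f"
  have "Poly_Mapping.single v d * f - Poly_Mapping.single u c * g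
        \<in> combinations le G {s. s \<sqsubset> v + lm le f}"
    using assms *[symmetric] by (rule cancellation_standardD)
  from combinations_uminus[OF this]
  show "Poly_Mapping.single u c * g - Poly_Mapping.single v d * f
        \<in> combinations le G {s. s \<sqsubset> u + lm le g}"
    by (simp add: *)
qed

text \<open>Cancelling the unit gives \<open>c = d\<close>, so the difference is zero. For a general
  lead coefficient it would be a multiple of the annihilator polynomial.\<close>

lemma cancellation_standard_same:
  assumes "lc le f dvd 1"
  shows "cancellation_standard G f f"
proof (rule cancellation_standardI)
  fix u v c d assume *: "u + lm le f = v + lm le f" "c * lc le f = d * lc le f"
  obtain b where b: "1 = lc le f * b" using assms by (rule dvdE)
  have "c = c * lc le f * b" using b by (simp add: mult.assoc)
  also have "\<dots> = d" using b by (simp add: mult.assoc *)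
  finally show "Poly_Mapping.single u c * f - Poly_Mapping.single v d * f
        \<in> combinations le G {s. s \<sqsubset> u + lm le f}"
    using * by (simp add: combinations.zero)
qed

text \<open>The lcm \<open>a\<close> of two units is a unit, so every cancellation is the multiple
  of \<open>p\<close> by one term, and multiplying by a monomial preserves strict bounds.\<close>

lemma spoly_cancellation_standard:
  fixes G :: "('v, 'r::comm_ring_1) mpoly set"
  assumes "is_spoly le f g p" "lc le f dvd 1" "lc le g dvd 1"
    and "p \<in> combinations le G {s. s \<sqsubset> mono_lcm (lm le f) (lm le g)}"
  shows "cancellation_standard G f g"
proof (rule cancellation_standardI)
  fix u v c d assume *: "u + lm le f = v + lm le g" "c * lc le f = d * lc le g"
  let ?t = "mono_lcm (lm le f) (lm le g)"
  obtain a af ag where a: "is_lcm (lc le f) (lc le g) a" "af * lc le f = a" "ag * lc le g = a"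
    "p = Poly_Mapping.single (?t - lm le f) af * f - Poly_Mapping.single (?t - lm le g) ag * g"
    using assms(1) by (rule is_spolyE)
  have "a dvd 1" using is_lcm_dvd_iff[OF a(1)] assms(2,3) by blast
  then obtain b where b: "1 = a * b" by (rule dvdE)
  obtain w where w: "u = w + (?t - lm le f)" "v = w + (?t - lm le g)" "u + lm le f = w + ?t"
    using *(1) by (rule common_multiple_mono_lcm)
  \<comment> \<open>Since \<open>b\<close> inverts \<open>a\<close>, this is the quotient of the
    cancelled coefficient \<open>c * lc le f\<close> by the lead coefficient \<open>a\<close> of the
    two parts of \<open>p\<close>.\<close>
  define k where "k = c * lc le f * b"
  have kf: "k * af = c"
  proof -
    have "k * af = c * ((af * lc le f) * b)"
      unfolding k_def by (simp only: mult_ac)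
    also have "\<dots> = c" unfolding a(2) b[symmetric] by simp
    finally show ?thesis .
  qed
  have kg: "k * ag = d"
  proof -
    have "k * ag = d * ((ag * lc le g) * b)"
      unfolding k_def *(2) by (simp only: mult_ac)
    also have "\<dots> = d" unfolding a(3) b[symmetric] by simp
    finally show ?thesis .
  qed
  have "Poly_Mapping.single w k * p = Poly_Mapping.single u c * f - Poly_Mapping.single v d * g"
    by (simp add: a(4) right_diff_distrib mult.assoc[symmetric] mult_single kf kg w(1,2)[symmetric])
  moreover have "Poly_Mapping.single w k * p \<in> combinations le G {s. s \<sqsubset> u + lm le f}"
    unfolding w(3) using le_add
    by (intro combinations_mono[OF combinations_shift[OF assms(4)]]) auto
  ultimately show "Poly_Mapping.single u c * f - Poly_Mapping.single v d * g
        \<in> combinations le G {s. s \<sqsubset> u + lm le f}" by simp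
qed

section \<open>Buchberger's criterion for unit lead coefficients\<close>

text \<open>Every summand at the top position \<open>t\<close> is traded for a multiple of one fixed
  \<open>g\<close>, at the cost of lower summands. As \<open>lc le g\<close> is a unit,
  \<open>g\<close> alone can do what in general takes GCD-polynomials.\<close>

lemma combinations_single_top_term:
  fixes G :: "('v, 'r::comm_ring_1) mpoly set"
  assumes "\<And>f g. f \<in> G \<Longrightarrow> g \<in> G \<Longrightarrow> cancellation_standard G f g"
    and "g \<in> G" "lc le g dvd 1" "v + lm le g = t"
    and "p \<in> combinations le G {s. s \<sqsubseteq> t}"
  shows "\<exists>d. p - Poly_Mapping.single v d * g \<in> combinations le G {s. s \<sqsubset> t}"
  using assms(5)
proof (induction rule: combinations.induct)
  case zero
  show ?case by (intro exI[of _ 0]) (simp add: combinations.zero)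
next
  case (step p f u c)
  then obtain d where d: "p - Poly_Mapping.single v d * g \<in> combinations le G {s. s \<sqsubset> t}"
    by blast
  show ?case
  proof (cases "u + lm le f = t")
    case True
    obtain b where b: "1 = lc le g * b" using assms(3) by (rule dvdE)
    \<comment> \<open>The quotient of \<open>c * lc le f\<close> by \<open>lc le g\<close>, with
      \<open>b\<close> the inverse of the latter.\<close>
    define e where "e = c * lc le f * b"
    have "e * lc le g = c * lc le f * (lc le g * b)"
      unfolding e_def by (simp only: mult_ac)
    then have "c * lc le f = e * lc le g" unfolding b[symmetric] by simp
    then have "Poly_Mapping.single u c * f - Poly_Mapping.single v e * g
        \<in> combinations le G {s. s \<sqsubset> t}"
      using cancellation_standardD[OF assms(1)[OF step(2) assms(2)], of u v c e] True assms(4)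
      by simp
    from combinations_add[OF d this] show ?thesis
      by (intro exI[of _ "d + e"]) (simp add: single_add algebra_simps)
  next
    case False
    with step(3) have "Poly_Mapping.single u c * f \<in> combinations le G {s. s \<sqsubset> t}"
      by (intro combinations_generator[OF step(2)]) simp
    from combinations_add[OF d this] show ?thesis
      by (intro exI[of _ d]) (simp add: algebra_simps)
  qed
qed

text \<open>Well-founded induction on the bound \<open>t\<close>. Either the bound can be lowered,
  or all top summands are collected into one multiple of some \<open>g\<close>; its coefficient at
  \<open>t\<close> survives, so \<open>t\<close> is the lead monomial of \<open>p\<close>.\<close>

lemma buchberger_criterion:
  fixes G :: "('v, 'r::comm_ring_1) mpoly set"
  assumes "\<And>f g. f \<in> G \<Longrightarrow> g \<in> G \<Longrightarrow> cancellation_standard G f g"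
    and "\<And>g. g \<in> G \<Longrightarrow> lc le g dvd 1"
    and "p \<in> ideal_generated G" "p \<noteq> 0"
  shows "\<exists>g\<in>G. mono_dvd (lm le g) (lm le p)"
proof -
  have "\<exists>g\<in>G. mono_dvd (lm le g) (lm le p)" if "p \<in> combinations le G {s. s \<sqsubseteq> t}" for t
    using wf_less that
  proof (induction t rule: wf_induct_rule)
    case (less t)
    show ?case
    proof (cases "p \<in> combinations le G {s. s \<sqsubset> t}")
      case True
      then obtain t' where "t' \<sqsubset> t" "p \<in> combinations le G {s. s \<sqsubseteq> t'}"
        using combinations_bounded assms(4) by blast
      with less.IH show ?thesis by blast
    next
      case False
      \<comment> \<open>Otherwise no summand reaches \<open>t\<close>, and the representation is
        already strictly below it.\<close>
      have "\<exists>g\<in>G. mono_dvd (lm le g) t"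
      proof (rule ccontr)
        assume no: "\<not> ?thesis"
        have "p \<in> combinations le G {s. s \<sqsubset> t}"
          using less.prems
        proof (induction rule: combinations.induct)
          case (step p g u c)
          then have "u + lm le g \<noteq> t" using no by (auto simp: mono_dvd_def add.commute)
          with step show ?case by (intro combinations.step) auto
        qed (rule combinations.zero)
        with False show False ..
      qed
      then obtain g where g: "g \<in> G" "mono_dvd (lm le g) t" by blast
      have v: "t - lm le g + lm le g = t" using g(2) by (rule mono_dvd_minus)
      obtain d where d: "p - Poly_Mapping.single (t - lm le g) d * g
          \<in> combinations le G {s. s \<sqsubset> t}"
        using combinations_single_top_term[OF assms(1) g(1) assms(2)[OF g(1)] v less.prems] by blast
      have "Poly_Mapping.keys (p - Poly_Mapping.single (t - lm le g) d * g) \<subseteq> {s. s \<sqsubset> t}"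
        using le_trans le_antisym by (intro keys_combinations[OF d]) blast
      then have "Poly_Mapping.lookup (p - Poly_Mapping.single (t - lm le g) d * g) t = 0"
        by (auto simp: in_keys_iff)
      then have top: "Poly_Mapping.lookup p t = d * lc le g"
        using lookup_single_times_lm[of "t - lm le g" d g] unfolding v by (simp add: lookup_minus)
      \<comment> \<open>With \<open>d = 0\<close>, the polynomial \<open>p\<close> itself would be a
        combination strictly below \<open>t\<close>. Multiplying by the unit \<open>lc le g\<close>
        then keeps \<open>d\<close> nonzero.\<close>
      have "d \<noteq> 0" using False d by auto
      then have "d * lc le g \<noteq> 0"
        using assms(2)[OF g(1)] by (metis dvd_def mult.assoc mult_1_right mult_zero_left)
      with top have "t \<in> Poly_Mapping.keys p" by (simp add: in_keys_iff)
      moreover have "Poly_Mapping.keys p \<subseteq> {s. s \<sqsubseteq> t}"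
        using le_trans by (intro keys_combinations[OF less.prems]) blast
      ultimately have "lm le p = t" by (intro lm_eqI) auto
      with g show ?thesis by blast
    qed
  qed
  then show ?thesis
    using combinations_bounded[OF ideal_generated_combinations[OF assms(3)] assms(4)] by blast
qed

lemma strong_groebner_basisI:
  fixes G :: "('v, 'r::comm_ring_1) mpoly set"
  assumes "finite G" "G \<subseteq> J" "J \<subseteq> ideal_generated G"
    and units: "\<And>g. g \<in> G \<Longrightarrow> lc le g dvd 1"
    and "\<And>f g. f \<in> G \<Longrightarrow> g \<in> G \<Longrightarrow> cancellation_standard G f g"
  shows "strong_groebner_basis le G J"
proof -
  have dvd: "\<exists>g\<in>G - {0}. lt le g dvd lt le f" if f: "f \<in> J - {0}" for f
  proof -
    obtain g where g: "g \<in> G" "mono_dvd (lm le g) (lm le f)"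
      using buchberger_criterion[OF assms(5) units] f assms(3) by blast
    obtain u where u: "lm le f = lm le g + u" using g(2) by (auto simp: mono_dvd_def)
    have "lc le g dvd lc le f" using units[OF g(1)] by (metis dvd_trans one_dvd)
    then obtain c where c: "lc le f = lc le g * c" by (rule dvdE)
    have "lt le f = lt le g * Poly_Mapping.single u c"
      by (simp add: lt_def u c mult_single)
    then have "lt le g dvd lt le f" by simp
    with g(1) lc_unit_nonzero[OF units[OF g(1)]] show ?thesis by blast
  qed
  have "lt le f \<in> lead_ideal le G" if f: "f \<in> J - {0}" for f
  proof -
    obtain g q where g: "g \<in> G - {0}" "lt le f = q * lt le g"
      using dvd[OF f] by (metis dvd_def mult.commute)
    then show ?thesis unfolding lead_ideal_def
      by (simp add: ring_module.span_scale ring_module.span_base)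
  qed
  then have "lead_ideal le J \<subseteq> lead_ideal le G"
    unfolding lead_ideal_def[of le J]
    by (intro ring_module.span_minimal) (auto simp: lead_ideal_def)
  moreover have "lead_ideal le G \<subseteq> lead_ideal le J"
    unfolding lead_ideal_def using assms(2) by (intro ring_module.span_mono) blast
  ultimately show ?thesis
    unfolding strong_groebner_basis_def using assms(1,2) dvd by blast
qed

end

section \<open>The algorithm\<close>

primrec pending :: "'p buchberger_state \<Rightarrow> 'p set"
  where
    "pending (Outer G P) = P"
  | "pending (Normalizing h G P) = P"

text \<open>The value 0 for \<open>Outer\<close> says that no remainder is left open: a resolved
  S-polynomial is then itself pending or a standard combination.\<close>

primrec current :: "'p::zero buchberger_state \<Rightarrow> 'p"
  where
    "current (Outer G P) = 0"
  | "current (Normalizing h G P) = h"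

text \<open>
  An S-polynomial that has left \<open>pending\<close> is a standard combination of the basis up to the
  remainder that is being normalized.
\<close>

definition spoly_resolved ::
  "('v monomial \<Rightarrow> 'v monomial \<Rightarrow> bool) \<Rightarrow> ('v, 'r::comm_ring_1) mpoly buchberger_state \<Rightarrow>
    ('v, 'r) mpoly \<Rightarrow> ('v, 'r) mpoly \<Rightarrow> bool"
  where "spoly_resolved le S f g \<longleftrightarrow>
    (let U = {s. le s (mono_lcm (lm le f) (lm le g)) \<and> s \<noteq> mono_lcm (lm le f) (lm le g)} in
     \<exists>p. is_spoly le f g p \<and>
       (p \<in> pending S \<or>
        (\<exists>q\<in>{0, current S}. p - q \<in> combinations le (basis S) U \<and> Poly_Mapping.keys q \<subseteq> U)))"

text \<open>An S-polynomial may have been chosen for one order of a pair only, hence the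
  disjunction; equal elements are covered by \<open>cancellation_standard_same\<close>. The two
  inclusions keep the ideal generated by the basis equal to that of \<open>F\<close>.\<close>

definition buchberger_invariant ::
  "('v monomial \<Rightarrow> 'v monomial \<Rightarrow> bool) \<Rightarrow> ('v, 'r::comm_ring_1) mpoly set \<Rightarrow>
    ('v, 'r) mpoly buchberger_state \<Rightarrow> bool"
  where "buchberger_invariant le F S \<longleftrightarrow>
    finite (basis S) \<and> finite (pending S) \<and> F \<subseteq> basis S \<and>
    insert (current S) (basis S \<union> pending S) \<subseteq> ideal_generated F \<and>
    (\<forall>g\<in>basis S. lc le g dvd 1) \<and>
    (\<forall>f\<in>basis S. \<forall>g\<in>basis S. f = g \<or> spoly_resolved le S f g \<or> spoly_resolved le S g f)"

lemma buchberger_invariant_initial: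
  fixes fs :: "('v, 'r::comm_ring_1) mpoly list"
  assumes "buchberger_initial le fs S" "\<forall>f\<in>set fs. lc le f dvd 1"
  shows "buchberger_invariant le (set fs) S"
proof -
  obtain s where s: "\<And>i j. i < j \<and> j < length fs \<Longrightarrow> is_spoly le (fs ! i) (fs ! j) (s i j)"
    and S: "S = Outer (set fs) {s i j |i j. i < j \<and> j < length fs}"
    using assms(1) unfolding buchberger_initial_def by blast
  have "{s i j |i j. i < j \<and> j < length fs} \<subseteq> case_prod s ` ({..<length fs} \<times> {..<length fs})"
    by auto
  then have fin: "finite (pending S)" unfolding S pending.simps by (rule finite_subset) simp
  have pend: "pending S \<subseteq> ideal_generated (set fs)"
  proof
    fix p assume "p \<in> pending S"
    then obtain i j where ij: "i < j" "j < length fs" "p = s i j" unfolding S by auto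
    have "is_spoly le (fs ! i) (fs ! j) p" using s[of i j] ij by simp
    then show "p \<in> ideal_generated (set fs)"
      using ring_module.subspace_span
    proof (rule is_spoly_mem_ideal)
      show "fs ! i \<in> ideal_generated (set fs)" "fs ! j \<in> ideal_generated (set fs)"
        using ij by (auto intro!: ring_module.span_base nth_mem)
    qed
  qed
  have resolved: "spoly_resolved le S (fs ! i) (fs ! j)" if "i < j" "j < length fs" for i j
    unfolding spoly_resolved_def Let_def using s that S by auto
  have "f = g \<or> spoly_resolved le S f g \<or> spoly_resolved le S g f"
    if "f \<in> set fs" "g \<in> set fs" for f g
  proof -
    from that obtain i j where "i < length fs" "j < length fs" "f = fs ! i" "g = fs ! j"
      unfolding in_set_conv_nth by blast
    with resolved show ?thesis by (cases i j rule: linorder_cases) auto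
  qed
  with fin pend assms(2) show ?thesis
    unfolding buchberger_invariant_def S
    by (auto simp: ring_module.span_base ring_module.span_zero)
qed

section \<open>Preservation of the invariant\<close>

lemma basis_mono_step: "buchberger_step le S S' \<Longrightarrow> basis S \<subseteq> basis S'"
  by (induction rule: buchberger_step.induct) auto

context monomial_order
begin

text \<open>A chosen \<open>p\<close> becomes its own remainder; a reduction moves a multiple of a
  basis element from the remainder to the combination; adding \<open>h\<close> to the basis makes
  the remainder a generator, so nothing is left over.\<close>

lemma spoly_resolved_step:
  fixes S :: "('v, 'r::comm_ring_1) mpoly buchberger_state"
  assumes "buchberger_step le S S'" "spoly_resolved le S f g"
  shows "spoly_resolved le S' f g"
proof -
  define t where "t = mono_lcm (lm le f) (lm le g)"
  define U where "U = {s. s \<sqsubset> t}"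
  have resolvedI: "spoly_resolved le T f g"
    if "is_spoly le f g p" "p \<in> pending T \<or>
      (\<exists>q\<in>{0, current T}. p - q \<in> combinations le (basis T) U \<and> Poly_Mapping.keys q \<subseteq> U)"
    for p and T :: "('v, 'r) mpoly buchberger_state"
    using that unfolding spoly_resolved_def Let_def U_def t_def by blast
  obtain p where p: "is_spoly le f g p" "p \<in> pending S \<or>
      (\<exists>q\<in>{0, current S}. p - q \<in> combinations le (basis S) U \<and> Poly_Mapping.keys q \<subseteq> U)"
    using assms(2) unfolding spoly_resolved_def Let_def U_def t_def by blast
  \<comment> \<open>Needed when \<open>p\<close> is taken from the pending set and serves as
    remainder \<open>q\<close>.\<close>
  have keys: "Poly_Mapping.keys p \<subseteq> U" using keys_spoly[OF p(1)] by (simp add: U_def t_def)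
  have down: "{s. s \<sqsubset> r} \<subseteq> U" "r \<in> U" if "h \<noteq> 0" "Poly_Mapping.keys h \<subseteq> U" "r = lm le h"
    for h :: "('v, 'r) mpoly" and r
  proof -
    show "r \<in> U" using lm_in_keys that by blast
    then show "{s. s \<sqsubset> r} \<subseteq> U" using less_trans unfolding U_def by blast
  qed
  from assms(1) show ?thesis
  proof cases
    case (choose h P G)
    show ?thesis
      using p keys combinations.zero unfolding choose
      by (intro resolvedI[OF p(1)]) auto
  next
    case (reduce G h h' P)
    obtain k u c where k: "k \<in> G" "u + lm le k = lm le h"
      "h' = h - Poly_Mapping.single u c * k" "Poly_Mapping.keys h' \<subseteq> {s. s \<sqsubset> lm le h}"
      using reduce(3) by (rule reduction_stepE)
    have "h \<noteq> 0" using reduce(3) by (simp add: reduction_step_def)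
    have *: "p - h' \<in> combinations le G U \<and> Poly_Mapping.keys h' \<subseteq> U"
      if h: "p - h \<in> combinations le G U" "Poly_Mapping.keys h \<subseteq> U"
    proof
      have "Poly_Mapping.single u c * k \<in> combinations le G U"
        using k(1,2) down(2)[OF \<open>h \<noteq> 0\<close> h(2)] by (intro combinations_generator) auto
      from combinations_add[OF h(1) this] show "p - h' \<in> combinations le G U"
        unfolding k(3) by (simp add: algebra_simps)
      show "Poly_Mapping.keys h' \<subseteq> U" using k(4) down(1)[OF \<open>h \<noteq> 0\<close> h(2)] by blast
    qed
    show ?thesis
      using p(2) * unfolding reduce by (intro resolvedI[OF p(1)]) auto
  next
    case (discard G P)
    show ?thesis using p(2) unfolding discard by (intro resolvedI[OF p(1)]) auto
  next
    case (add h G s P)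
    have G: "q \<in> combinations le (insert h G) U" if "q \<in> combinations le G U" for q
      using that by (rule combinations_mono) auto
    have *: "p \<in> combinations le (insert h G) U"
      if h: "p - h \<in> combinations le G U" "Poly_Mapping.keys h \<subseteq> U"
    proof -
      \<comment> \<open>The remainder is the new basis element times the constant 1, and its lead
        monomial lies in \<open>U\<close>.\<close>
      have "Poly_Mapping.single 0 1 * h \<in> combinations le (insert h G) U"
        using down(2)[OF add(3) h(2)] by (intro combinations_generator) auto
      from combinations_add[OF G[OF h(1)] this] show ?thesis by simp
    qed
    show ?thesis
      using p(2) G * unfolding add by (intro resolvedI[OF p(1)]) auto
  qed
qed

lemma buchberger_invariant_step:
  fixes S :: "('v, 'r::comm_ring_1) mpoly buchberger_state"
  assumes "buchberger_step_unit le S S'" "buchberger_invariant le F S"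
  shows "buchberger_invariant le F S'"
proof -
  have step: "buchberger_step le S S'" and unit: "\<And>h. h \<in> basis S' - basis S \<Longrightarrow> lc le h dvd 1"
    using assms(1) by (auto simp: buchberger_step_unit_def)
  have fin: "finite (basis S)" "finite (pending S)" and F: "F \<subseteq> basis S"
    and cur: "current S \<in> ideal_generated F" and bas: "basis S \<subseteq> ideal_generated F"
    and pend: "pending S \<subseteq> ideal_generated F"
    and units: "\<And>g. g \<in> basis S \<Longrightarrow> lc le g dvd 1"
    and res: "\<And>f g. f \<in> basis S \<Longrightarrow> g \<in> basis S \<Longrightarrow>
      f = g \<or> spoly_resolved le S f g \<or> spoly_resolved le S g f"
    using assms(2) unfolding buchberger_invariant_def by auto
  have "finite (basis S') \<and> finite (pending S')"
    using step fin by cases auto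
  moreover have "F \<subseteq> basis S'" using F basis_mono_step[OF step] by blast
  moreover have "insert (current S') (basis S' \<union> pending S') \<subseteq> ideal_generated F"
    using step
  proof cases
    case (choose h P G)
    with bas pend show ?thesis by auto
  next
    case (reduce G h h' P)
    obtain k u c where "k \<in> G" "h' = h - Poly_Mapping.single u c * k"
      using reduce(3) by (rule reduction_stepE)
    moreover from this have "h \<in> ideal_generated F" "k \<in> ideal_generated F"
      using cur bas reduce(1) by auto
    ultimately have "h' \<in> ideal_generated F"
      by (simp add: ring_module.span_diff ring_module.span_scale)
    with bas pend show ?thesis unfolding reduce by simp
  next
    case (discard G P)
    with bas pend show ?thesis by (simp add: ring_module.span_zero)
  next
    case (add h G s P)
    have "s g \<in> ideal_generated F" if "g \<in> G" for g
    proof -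
      have "is_spoly le g h (s g)" using add(5) that by blast
      moreover have "g \<in> ideal_generated F" "h \<in> ideal_generated F"
        using add(1) that cur bas by auto
      ultimately show ?thesis by (rule is_spoly_mem_ideal[OF _ ring_module.subspace_span])
    qed
    with cur bas pend show ?thesis unfolding add by (auto simp: ring_module.span_zero)
  qed
  moreover have "lc le g dvd 1" if "g \<in> basis S'" for g using that unit units by blast
  moreover have "f = g \<or> spoly_resolved le S' f g \<or> spoly_resolved le S' g f"
    if fg: "f \<in> basis S'" "g \<in> basis S'" for f g
  proof (cases "f \<in> basis S \<and> g \<in> basis S")
    case True
    then show ?thesis using res spoly_resolved_step[OF step] by blast
  next
    \<comment> \<open>Only \<open>add\<close> enlarges the basis, and the S-polynomials of the new
      element with the old ones are pending right after it.\<close>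
    case False
    from step show ?thesis
    proof cases
      case (add h G s P)
      have "spoly_resolved le S' k h" if "k \<in> G" for k
        using add that unfolding spoly_resolved_def Let_def by auto
      with False fg show ?thesis unfolding add by auto
    qed (use False fg in auto)
  qed
  ultimately show ?thesis unfolding buchberger_invariant_def by blast
qed

section \<open>Final states\<close>

text \<open>Every normalizing state can continue, and so can an outer state with pending
  polynomials. In the remaining case nothing is pending and no remainder is open, so all
  S-polynomials are standard and the criterion applies.\<close>

lemma buchberger_invariant_final:
  fixes S :: "('v, 'r::comm_ring_1) mpoly buchberger_state"
  assumes "principal_ideal_ring TYPE('r)" "buchberger_invariant le F S"
    and "\<nexists>S'. buchberger_step le S S'"
  shows "\<exists>G. S = Outer G {} \<and> strong_groebner_basis le G (ideal_generated F)"
proof (cases S)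
  case (Outer G P)
  have "P = {}" using assms(3) buchberger_step.choose unfolding Outer by blast
  with Outer have S: "S = Outer G {}" by simp
  have inv: "finite G" "F \<subseteq> G" "G \<subseteq> ideal_generated F" "\<And>g. g \<in> G \<Longrightarrow> lc le g dvd 1"
    "\<And>f g. f \<in> G \<Longrightarrow> g \<in> G \<Longrightarrow> f = g \<or> spoly_resolved le S f g \<or> spoly_resolved le S g f"
    using assms(2) unfolding buchberger_invariant_def S by auto
  have resolved: "cancellation_standard G f g"
    if fg: "f \<in> G" "g \<in> G" and res: "spoly_resolved le S f g" for f g
  proof -
    obtain p where "is_spoly le f g p"
      "p \<in> combinations le G {s. s \<sqsubset> mono_lcm (lm le f) (lm le g)}"
      using res unfolding spoly_resolved_def Let_def S by auto
    with inv(4) fg show ?thesis by (intro spoly_cancellation_standard)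
  qed
  have "cancellation_standard G f g" if "f \<in> G" "g \<in> G" for f g
    using inv(5)[OF that] that resolved cancellation_standard_commute
      cancellation_standard_same inv(4) by blast
  then have "strong_groebner_basis le G (ideal_generated F)"
    using inv ring_module.span_mono[OF inv(2)] by (intro strong_groebner_basisI)
  with S show ?thesis by blast
next
  case (Normalizing h G P)
  have "h \<noteq> 0" using assms(3) buchberger_step.discard unfolding Normalizing by blast
  moreover have "\<nexists>h'. reduction_step le G h h'"
    using assms(3) buchberger_step.reduce unfolding Normalizing by blast
  moreover have "\<forall>g. \<exists>p. is_spoly le g h p" using ex_is_spoly[OF assms(1)] by blast
  then obtain s where "\<forall>g\<in>G. is_spoly le g h (s g)" unfolding choice_iff by blast
  ultimately show ?thesis
    using assms(3) buchberger_step.add unfolding Normalizing by blast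
qed

section \<open>Termination\<close>

lemma basis_growth:
  fixes S :: "('v, 'r::comm_ring_1) mpoly buchberger_state"
  assumes "buchberger_step le S S'" "basis S' \<noteq> basis S"
    and "\<And>g. g \<in> basis S \<Longrightarrow> lc le g dvd 1"
  obtains h where "h \<in> basis S'" "\<forall>g\<in>basis S. \<not> mono_dvd (lm le g) (lm le h)"
  using assms(1)
proof cases
  case (add h G s P)
  then show thesis
    using assms(3) irreducible_not_mono_dvd[OF add(3,4)] by (intro that[of h]) auto
qed (use assms(2) in auto)

text \<open>Infinitely many growth steps would give a sequence of lead monomials in which no earlier
  one divides a later one, against Dickson's lemma.\<close>

lemma basis_eventually_constant:
  fixes \<sigma> :: "nat \<Rightarrow> ('v, 'r::comm_ring_1) mpoly buchberger_state"
  assumes step: "\<And>n. buchberger_step le (\<sigma> n) (\<sigma> (Suc n))"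
    and units: "\<And>n g. g \<in> basis (\<sigma> n) \<Longrightarrow> lc le g dvd 1"
  shows "\<exists>N. \<forall>n\<ge>N. basis (\<sigma> (Suc n)) = basis (\<sigma> n)"
proof (rule ccontr)
  define A where "A = {n. basis (\<sigma> (Suc n)) \<noteq> basis (\<sigma> n)}"
  assume "\<not> ?thesis"
  then have A: "infinite A" unfolding A_def infinite_nat_iff_unbounded_le by auto
  have "\<exists>h. h \<in> basis (\<sigma> (Suc n)) \<and> (\<forall>g\<in>basis (\<sigma> n). \<not> mono_dvd (lm le g) (lm le h))"
    if "n \<in> A" for n
  proof -
    have ne: "basis (\<sigma> (Suc n)) \<noteq> basis (\<sigma> n)" using that by (simp add: A_def)
    obtain h where "h \<in> basis (\<sigma> (Suc n))"
      "\<forall>g\<in>basis (\<sigma> n). \<not> mono_dvd (lm le g) (lm le h)"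
      using step ne units by (rule basis_growth)
    then show ?thesis by blast
  qed
  then obtain h where h: "\<And>n. n \<in> A \<Longrightarrow> h n \<in> basis (\<sigma> (Suc n))"
    "\<And>n g. n \<in> A \<Longrightarrow> g \<in> basis (\<sigma> n) \<Longrightarrow> \<not> mono_dvd (lm le g) (lm le (h n))"
    by metis
  have mono: "basis (\<sigma> m) \<subseteq> basis (\<sigma> n)" if "m \<le> n" for m n
    using that basis_mono_step[OF step] by (rule lift_Suc_mono_le[rotated])
  obtain i j where ij: "i < j"
    "mono_dvd (lm le (h (enumerate A i))) (lm le (h (enumerate A j)))"
    by (rule dickson[of "\<lambda>n. lm le (h (enumerate A n))"])
  \<comment> \<open>The polynomial of the \<open>i\<close>-th growth step lies in the basis one step
    later, hence still at the \<open>j\<close>-th growth step.\<close>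
  have "Suc (enumerate A i) \<le> enumerate A j" using enumerate_mono[OF ij(1) A] by simp
  then have "h (enumerate A i) \<in> basis (\<sigma> (enumerate A j))"
    using h(1)[OF enumerate_in_set[OF A]] mono by blast
  with h(2)[OF enumerate_in_set[OF A]] ij(2) show False by blast
qed

text \<open>The factor 2 leaves room for an odd value during normalization, so both choosing and
  discarding decrease the first component. The flag makes a reduction to 0 decrease before the lead
  monomials are compared, as that of 0 is meaningless.\<close>

primrec progress ::
  "('v, 'r::comm_ring_1) mpoly buchberger_state \<Rightarrow> nat \<times> nat \<times> 'v monomial"
  where
    "progress (Outer G P) = (2 * card P, 0, 0)"
  | "progress (Normalizing h G P) = (2 * card P + 1, of_bool (h \<noteq> 0), lm le h)"

lemma progress_decreases:
  fixes S :: "('v, 'r::comm_ring_1) mpoly buchberger_state"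
  assumes "buchberger_step le S S'" "basis S' = basis S" "finite (pending S)"
    and "\<And>g. g \<in> basis S \<Longrightarrow> lc le g dvd 1"
  shows "(progress S', progress S) \<in> less_than <*lex*> less_than <*lex*> {(s, t). s \<sqsubset> t}"
  using assms(1)
proof cases
  case (choose h P G)
  then have "card P \<noteq> 0" using assms(3) by auto
  with choose show ?thesis by (auto simp: card_Diff_singleton)
next
  case (reduce G h h' P)
  have "Poly_Mapping.keys h' \<subseteq> {s. s \<sqsubset> lm le h}"
    using reduce(3) by (rule reduction_stepE)
  then have "lm le h' \<sqsubset> lm le h" if "h' \<noteq> 0" using lm_in_keys[OF that] by blast
  with reduce show ?thesis by (auto simp: reduction_step_def)
next
  case (discard G P)
  then show ?thesis by simp
next
  case (add h G s P)
  \<comment> \<open>With a constant basis, the added \<open>h\<close> would already be in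
    \<open>G\<close> and so be reducible by itself.\<close>
  then have h: "h \<in> G" using assms(2) by auto
  with add assms(4) have "\<not> mono_dvd (lm le h) (lm le h)"
    by (intro irreducible_not_mono_dvd) auto
  then show ?thesis by (simp add: mono_dvdI)
qed

lemma buchberger_terminates:
  fixes \<sigma> :: "nat \<Rightarrow> ('v, 'r::comm_ring_1) mpoly buchberger_state"
  assumes step: "\<And>n. buchberger_step le (\<sigma> n) (\<sigma> (Suc n))"
    and inv: "\<And>n. buchberger_invariant le F (\<sigma> n)"
  shows False
proof -
  have units: "\<And>n g. g \<in> basis (\<sigma> n) \<Longrightarrow> lc le g dvd 1" and fin: "\<And>n. finite (pending (\<sigma> n))"
    using inv unfolding buchberger_invariant_def by blast+
  have "\<exists>N. \<forall>n\<ge>N. basis (\<sigma> (Suc n)) = basis (\<sigma> n)"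
    by (rule basis_eventually_constant) (fact step, erule units)
  then obtain N where N: "\<And>n. n \<ge> N \<Longrightarrow> basis (\<sigma> (Suc n)) = basis (\<sigma> n)" by blast
  let ?R = "less_than <*lex*> less_than <*lex*> {(s, t). s \<sqsubset> t}"
  have "(progress (\<sigma> (Suc (N + n))), progress (\<sigma> (N + n))) \<in> ?R" for n
    by (intro progress_decreases step N fin) (auto intro: units)
  moreover have "wf ?R" by (intro wf_lex_prod wf_less_than wf_less)
  ultimately show False
    unfolding wf_iff_no_infinite_down_chain
    by (elim notE, intro exI[of _ "\<lambda>n. progress (\<sigma> (N + n))"]) simp
qed

end

text \<open>Runs use unit steps, but the end of a run is judged by \<open>buchberger_step\<close>: a
  state that could only continue by adding a polynomial with non-invertible lead coefficient does
  not count as final.\<close>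

theorem lemma8:
  fixes le :: "'v::finite monomial \<Rightarrow> 'v monomial \<Rightarrow> bool"
    and fs :: "('v, 'r::comm_ring_1) mpoly list"
  assumes "principal_ideal_ring TYPE('r)"
    and "global_monomial_order le"
    and "\<forall>f\<in>set fs. lc le f dvd 1"
  shows "(\<nexists>\<sigma> :: nat \<Rightarrow> ('v, 'r) mpoly buchberger_state.
            buchberger_initial le fs (\<sigma> 0) \<and>
            (\<forall>n. buchberger_step_unit le (\<sigma> n) (\<sigma> (Suc n)))) \<and>
         (\<forall>S0 S. buchberger_initial le fs S0 \<and> (buchberger_step_unit le)\<^sup>*\<^sup>* S0 S \<and>
            (\<nexists>S'. buchberger_step le S S') \<longrightarrow>
            (\<exists>G. S = Outer G {} \<and> strong_groebner_basis le G (ideal_generated (set fs))))"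
proof (intro conjI notI allI impI)
  interpret monomial_order le using assms(2) by unfold_locales
  note initial = buchberger_invariant_initial[OF _ assms(3)]
  {
    assume "\<exists>\<sigma> :: nat \<Rightarrow> ('v, 'r) mpoly buchberger_state. buchberger_initial le fs (\<sigma> 0) \<and>
      (\<forall>n. buchberger_step_unit le (\<sigma> n) (\<sigma> (Suc n)))"
    then obtain \<sigma> :: "nat \<Rightarrow> ('v, 'r) mpoly buchberger_state"
      where \<sigma>: "buchberger_initial le fs (\<sigma> 0)"
        "\<And>n. buchberger_step_unit le (\<sigma> n) (\<sigma> (Suc n))" by blast
    have "buchberger_invariant le (set fs) (\<sigma> n)" for n
      by (induction n) (use \<sigma> initial buchberger_invariant_step in blast)+
    then show False
      using \<sigma>(2) by (intro buchberger_terminates[of \<sigma>]) (auto simp: buchberger_step_unit_def)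
  next
    fix S0 S
    assume *: "buchberger_initial le fs S0 \<and> (buchberger_step_unit le)\<^sup>*\<^sup>* S0 S \<and>
      (\<nexists>S'. buchberger_step le S S')"
    then have "(buchberger_step_unit le)\<^sup>*\<^sup>* S0 S" by blast
    then have "buchberger_invariant le (set fs) S"
      by (induction rule: rtranclp_induct) (use * initial buchberger_invariant_step in blast)+
    with * show "\<exists>G. S = Outer G {} \<and> strong_groebner_basis le G (ideal_generated (set fs))"
      by (intro buchberger_invariant_final[OF assms(1)]) auto
  }
qed

end
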